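(* Let $M$ be an affine algebraic monoid with zero element $0\in M$, let $\lambda$ be a non-trivial polynomial character of $M$, and let $\Omega$ be a proper $\Omega$-process on $\Bbbk[M]$ associated to $\lambda$. For a polynomial $M$-module $V$ with comodule structure $\chi(v)=\sum v_0\otimes v_1$ let $$I_{1,1}:V\to V,\qquad I_{1,1}(v)=\sum v_0\,\Omega(\lambda v_1)(0).$$ Then $\mathcal R_V=\frac{1}{\Omega(\lambda)}I_{1,1}:V\to V$ is a Reynolds operator for the category of polynomial $M$-modules.
   Context: $\Bbbk$ is an algebraically closed field of characteristic zero. An affine algebraic monoid $M$ is an irreducible affine normal algebraic variety over $\Bbbk$ with an associative product $M\times M\to M$ that is a morphism of varieties and has a neutral element $1$. A zero element is $0\in M$ with $0m=m0=0$ for all $m$. The product induces a bialgebra structure on $\Bbbk[M]$. A polynomial $M$-module is a counital comodule $\chi:V\to V\otimes\Bbbk[M]$ for $\Bbbk[M]$ (equivalently, a locally finite linear action of $M$ with regular matrix coefficients), with $m\cdot v=\sum v_1(m)v_0$ if $\chi(v)=\sum v_0\otimes v_1$. $V^M=\{v\in V:\chi(v)=v\otimes 1\}$ is the subspace of $M$-invariants. A Reynolds operator for the category of polynomial $M$-modules is a family of linear maps $\mathcal R_V:V\to V$, one for each polynomial $M$-module $V$, such that $\mathcal R_V(V)\subset V^M$, $\mathcal R_V(v)=v$ for all $v\in V^M$, and $f\circ\mathcal R_V=\mathcal R_W\circ f$ for every morphism $f:V\to W$ of polynomial $M$-modules. A polynomial character of $M$ is a multiplicative morphism $\lambda:M\to\Bbbk$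 with $\lambda(1)=1$; it is trivial if it takes only the value $1$. For $f\in\Bbbk[M]$, $m\in M$, put $(m\cdot f)(x)=f(xm)$ and $(f\cdot m)(x)=f(mx)$. An $\Omega$-process associated to $\lambda$ is a non-zero linear operator $\Omega:\Bbbk[M]\to\Bbbk[M]$ such that $\Omega(f\cdot m)=\lambda(m)\,\Omega(f)\cdot m$ and $\Omega(m\cdot f)=\lambda(m)\,m\cdot\Omega(f)$ for all $f\in\Bbbk[M]$, $m\in M$. For $s\ge1$ set $\alpha_s=\Omega(\lambda^s)(1)$ (one has $\Omega(\lambda^s)=\alpha_s\lambda^{s-1}$, so $\Omega(\lambda)=\alpha_1$ is a constant, regarded as an element of $\Bbbk$); $\Omega$ is proper if $\alpha_s\neq0$ for all $s=1,2,\dots$. *)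

theory Defs
  imports
    "HOL-Computational_Algebra.Polynomial"
    "HOL-Library.Function_Algebras"
    "HOL-Library.Multiset"
begin

section \<open>Affine varieties and affine algebraic monoids\<close>

text \<open>
  An affine variety is given as a pair of a point set and its coordinate algebra. The point set is
  the whole type \<open>'m\<close>, and the coordinate algebra \<open>A\<close> is a set of functions \<open>'m \<Rightarrow> 'k\<close>, whose
  algebra operations \<open>+\<close>, \<open>*\<close>, \<open>0\<close>, \<open>1\<close>, \<open>^\<close> are the pointwise ones of \<^theory>\<open>HOL-Library.Function_Algebras\<close>.
\<close>

definition fun_scale :: "'k::times \<Rightarrow> ('m \<Rightarrow> 'k) \<Rightarrow> 'm \<Rightarrow> 'k" where
  "fun_scale c f = (\<lambda>x. c * f x)"

inductive_set generated_algebra :: "('m \<Rightarrow> 'k::comm_ring_1) set \<Rightarrow> ('m \<Rightarrow> 'k) set"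
  for G :: "('m \<Rightarrow> 'k) set" where
  generated_algebra_const: "(\<lambda>_. c) \<in> generated_algebra G"
| generated_algebra_gen: "g \<in> G \<Longrightarrow> g \<in> generated_algebra G"
| generated_algebra_add: "f \<in> generated_algebra G \<Longrightarrow> g \<in> generated_algebra G \<Longrightarrow> f + g \<in> generated_algebra G"
| generated_algebra_mult: "f \<in> generated_algebra G \<Longrightarrow> g \<in> generated_algebra G \<Longrightarrow> f * g \<in> generated_algebra G"

definition algebra_hom_to_field :: "('m \<Rightarrow> 'k::comm_ring_1) set \<Rightarrow> (('m \<Rightarrow> 'k) \<Rightarrow> 'k) \<Rightarrow> bool" where
  "algebra_hom_to_field A \<phi> \<longleftrightarrow>
     \<phi> 1 = 1 \<and>
     (\<forall>f\<in>A. \<forall>g\<in>A. \<phi> (f + g) = \<phi> f + \<phi> g \<and> \<phi> (f * g) = \<phi> f * \<phi> g) \<and>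
     (\<forall>c. \<forall>f\<in>A. \<phi> (fun_scale c f) = c * \<phi> f)"

text \<open>
  If \<open>G = {x\<^sub>1, \<dots>, x\<^sub>n}\<close> generates \<open>A\<close>, the condition on \<open>\<phi>\<close> below says exactly that
  \<open>(x\<^sub>1, \<dots>, x\<^sub>n)\<close> is a bijection of the point set onto the zero set in affine \<open>n\<close>-space of the
  polynomial relations between \<open>x\<^sub>1, \<dots>, x\<^sub>n\<close>; so \<open>A\<close> consists of the restrictions of the polynomial
  functions to a Zariski closed subset of affine space.
\<close>

definition affine_variety :: "('m \<Rightarrow> 'k::alg_closed_field) set \<Rightarrow> bool" where
  "affine_variety A \<longleftrightarrow>
     (\<exists>G. finite G \<and> A = generated_algebra G) \<and>
     (\<forall>\<phi>. algebra_hom_to_field A \<phi> \<longrightarrow> (\<exists>!x. \<forall>f\<in>A. \<phi> f = f x))"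

definition zariski_closed :: "('m \<Rightarrow> 'k::zero) set \<Rightarrow> 'm set \<Rightarrow> bool" where
  "zariski_closed A Z \<longleftrightarrow> (\<exists>S\<subseteq>A. Z = {x. \<forall>f\<in>S. f x = 0})"

definition irreducible_variety :: "('m \<Rightarrow> 'k::zero) set \<Rightarrow> bool" where
  "irreducible_variety A \<longleftrightarrow>
     (UNIV :: 'm set) \<noteq> {} \<and>
     (\<forall>Z Z'. zariski_closed A Z \<and> zariski_closed A Z' \<and> Z \<union> Z' = UNIV \<longrightarrow> Z = UNIV \<or> Z' = UNIV)"

text \<open>
  For an irreducible variety: the coordinate algebra is integrally closed in its field of fractions.
  The equation of integral dependence
  \<open>(f/g)^n + a\<^sub>n\<^sub>-\<^sub>1 (f/g)^(n-1) + \<dots> + a\<^sub>0 = 0\<close> is multiplied by \<open>g^n\<close>.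
\<close>

definition normal_variety :: "('m \<Rightarrow> 'k::comm_ring_1) set \<Rightarrow> bool" where
  "normal_variety A \<longleftrightarrow>
     (\<forall>f\<in>A. \<forall>g\<in>A. g \<noteq> 0 \<longrightarrow>
        (\<exists>n>0. \<exists>a. (\<forall>i<n. a i \<in> A) \<and> f ^ n + (\<Sum>i<n. a i * f ^ i * g ^ (n - i)) = 0) \<longrightarrow>
        (\<exists>h\<in>A. f = g * h))"

definition product_algebra ::
  "('m \<Rightarrow> 'k::comm_ring_1) set \<Rightarrow> ('n \<Rightarrow> 'k) set \<Rightarrow> ('m \<times> 'n \<Rightarrow> 'k) set" where
  "product_algebra A B =
     {(\<lambda>(x, y). \<Sum>(g, h)\<in>#t. g x * h y) | t. set_mset t \<subseteq> A \<times> B}"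

definition variety_morphism ::
  "('m \<Rightarrow> 'k) set \<Rightarrow> ('n \<Rightarrow> 'k) set \<Rightarrow> ('m \<Rightarrow> 'n) \<Rightarrow> bool" where
  "variety_morphism A B \<phi> \<longleftrightarrow> (\<forall>f\<in>B. f \<circ> \<phi> \<in> A)"

definition affine_algebraic_monoid ::
  "('m::monoid_mult \<Rightarrow> 'k::{alg_closed_field, field_char_0}) set \<Rightarrow> bool" where
  "affine_algebraic_monoid A \<longleftrightarrow>
     affine_variety A \<and> irreducible_variety A \<and> normal_variety A \<and>
     variety_morphism (product_algebra A A) A (\<lambda>(x, y). x * y)"

definition polynomial_character ::
  "('m::monoid_mult \<Rightarrow> 'k::comm_ring_1) set \<Rightarrow> ('m \<Rightarrow> 'k) \<Rightarrow> bool" where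
  "polynomial_character A lam \<longleftrightarrow>
     lam \<in> A \<and> (\<forall>x y. lam (x * y) = lam x * lam y) \<and> lam 1 = 1"

definition trivial_character :: "('m \<Rightarrow> 'k::one) \<Rightarrow> bool" where
  "trivial_character lam \<longleftrightarrow> (\<forall>x. lam x = 1)"


section \<open>Tensor products\<close>

text \<open>
  Elements of \<open>U \<otimes> W\<close> and \<open>U \<otimes> W \<otimes> X\<close> are represented by formal sums, i.e. multisets of
  pairs or triples; two formal sums represent the same tensor iff they are related by the congruence
  generated by the multilinearity relations. Additive inverses need not be formal: the class of
  \<open>(- u, w)\<close> is inverse to that of \<open>(u, w)\<close>. The functions \<open>s\<close>, \<open>s'\<close>, \<open>s''\<close> are the scalar
  multiplications.
\<close>

inductive generated_congruence ::
  "('a multiset \<Rightarrow> 'a multiset \<Rightarrow> bool) \<Rightarrow> 'a multiset \<Rightarrow> 'a multiset \<Rightarrow> bool"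
  for R :: "'a multiset \<Rightarrow> 'a multiset \<Rightarrow> bool" where
  congruence_base: "R t t' \<Longrightarrow> generated_congruence R t t'"
| congruence_refl: "generated_congruence R t t"
| congruence_sym: "generated_congruence R t t' \<Longrightarrow> generated_congruence R t' t"
| congruence_trans: "generated_congruence R t t' \<Longrightarrow> generated_congruence R t' t'' \<Longrightarrow>
    generated_congruence R t t''"
| congruence_add: "generated_congruence R t t' \<Longrightarrow> generated_congruence R r r' \<Longrightarrow>
    generated_congruence R (t + r) (t' + r')"

inductive bilinear_rel ::
  "('k \<Rightarrow> 'u \<Rightarrow> 'u::ab_group_add) \<Rightarrow> ('k \<Rightarrow> 'w \<Rightarrow> 'w::ab_group_add) \<Rightarrow> 'u set \<Rightarrow> 'w set \<Rightarrow>
    ('u \<times> 'w) multiset \<Rightarrow> ('u \<times> 'w) multiset \<Rightarrow> bool"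
  for s :: "'k \<Rightarrow> 'u \<Rightarrow> 'u::ab_group_add" and s' :: "'k \<Rightarrow> 'w \<Rightarrow> 'w::ab_group_add"
    and U :: "'u set" and W :: "'w set" where
  bilinear_zero: "w \<in> W \<Longrightarrow> bilinear_rel s s' U W {#(0, w)#} {#}"
| bilinear_add_left: "u \<in> U \<Longrightarrow> u' \<in> U \<Longrightarrow> w \<in> W \<Longrightarrow>
    bilinear_rel s s' U W {#(u + u', w)#} {#(u, w), (u', w)#}"
| bilinear_add_right: "u \<in> U \<Longrightarrow> w \<in> W \<Longrightarrow> w' \<in> W \<Longrightarrow>
    bilinear_rel s s' U W {#(u, w + w')#} {#(u, w), (u, w')#}"
| bilinear_scale: "u \<in> U \<Longrightarrow> w \<in> W \<Longrightarrow> bilinear_rel s s' U W {#(s c u, w)#} {#(u, s' c w)#}"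

definition tensor_eq where
  "tensor_eq s s' U W = generated_congruence (bilinear_rel s s' U W)"

inductive trilinear_rel ::
  "('k \<Rightarrow> 'u \<Rightarrow> 'u::ab_group_add) \<Rightarrow> ('k \<Rightarrow> 'w \<Rightarrow> 'w::ab_group_add) \<Rightarrow>
    ('k \<Rightarrow> 'x \<Rightarrow> 'x::ab_group_add) \<Rightarrow> 'u set \<Rightarrow> 'w set \<Rightarrow> 'x set \<Rightarrow>
    ('u \<times> 'w \<times> 'x) multiset \<Rightarrow> ('u \<times> 'w \<times> 'x) multiset \<Rightarrow> bool"
  for s :: "'k \<Rightarrow> 'u \<Rightarrow> 'u::ab_group_add" and s' :: "'k \<Rightarrow> 'w \<Rightarrow> 'w::ab_group_add"
    and s'' :: "'k \<Rightarrow> 'x \<Rightarrow> 'x::ab_group_add"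
    and U :: "'u set" and W :: "'w set" and X :: "'x set" where
  trilinear_zero: "w \<in> W \<Longrightarrow> x \<in> X \<Longrightarrow> trilinear_rel s s' s'' U W X {#(0, w, x)#} {#}"
| trilinear_add1: "u \<in> U \<Longrightarrow> u' \<in> U \<Longrightarrow> w \<in> W \<Longrightarrow> x \<in> X \<Longrightarrow>
    trilinear_rel s s' s'' U W X {#(u + u', w, x)#} {#(u, w, x), (u', w, x)#}"
| trilinear_add2: "u \<in> U \<Longrightarrow> w \<in> W \<Longrightarrow> w' \<in> W \<Longrightarrow> x \<in> X \<Longrightarrow>
    trilinear_rel s s' s'' U W X {#(u, w + w', x)#} {#(u, w, x), (u, w', x)#}"
| trilinear_add3: "u \<in> U \<Longrightarrow> w \<in> W \<Longrightarrow> x \<in> X \<Longrightarrow> x' \<in> X \<Longrightarrow>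
    trilinear_rel s s' s'' U W X {#(u, w, x + x')#} {#(u, w, x), (u, w, x')#}"
| trilinear_scale12: "u \<in> U \<Longrightarrow> w \<in> W \<Longrightarrow> x \<in> X \<Longrightarrow>
    trilinear_rel s s' s'' U W X {#(s c u, w, x)#} {#(u, s' c w, x)#}"
| trilinear_scale23: "u \<in> U \<Longrightarrow> w \<in> W \<Longrightarrow> x \<in> X \<Longrightarrow>
    trilinear_rel s s' s'' U W X {#(u, s' c w, x)#} {#(u, w, s'' c x)#}"

definition tensor3_eq where
  "tensor3_eq s s' s'' U W X = generated_congruence (trilinear_rel s s' s'' U W X)"


section \<open>Polynomial modules\<close>

text \<open>
  A formal sum representing \<open>\<Delta>(f) = \<Sum> f\<^sub>1 \<otimes> f\<^sub>2 \<in> A \<otimes> A\<close>, where \<open>A \<otimes> A\<close> is identified with the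
  coordinate algebra of the product, so that \<open>f (x * y) = \<Sum> f\<^sub>1 x * f\<^sub>2 y\<close>. The choice of the formal
  sum is immaterial, as such sums are only compared up to equality of tensors.
\<close>

definition comultiplication ::
  "('m::monoid_mult \<Rightarrow> 'k::comm_ring_1) set \<Rightarrow> ('m \<Rightarrow> 'k) \<Rightarrow> (('m \<Rightarrow> 'k) \<times> ('m \<Rightarrow> 'k)) multiset" where
  "comultiplication A f =
     (SOME t. set_mset t \<subseteq> A \<times> A \<and> (\<forall>x y. f (x * y) = (\<Sum>(g, h)\<in>#t. g x * h y)))"

definition counit :: "('m::monoid_mult \<Rightarrow> 'k) \<Rightarrow> 'k" where
  "counit f = f 1"

text \<open>
  The underlying vector space of a module is a linear subspace of an ambient vector space \<open>'v\<close> with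
  scalar multiplication \<open>s\<close>, which serves as a universe: \<open>'v\<close> and \<open>s\<close> are arbitrary, and any
  family of vector spaces lies in a common ambient space, namely its direct sum.
  The formal sum \<open>coact V v\<close> represents \<open>\<chi>(v) = \<Sum> v\<^sub>0 \<otimes> v\<^sub>1\<close>.
\<close>

record ('m, 'k, 'v) comodule_data =
  underlying_space :: "'v set"
  coact :: "'v \<Rightarrow> ('v \<times> ('m \<Rightarrow> 'k)) multiset"

definition polynomial_module ::
  "('m::monoid_mult \<Rightarrow> 'k::field) set \<Rightarrow> ('k \<Rightarrow> 'v \<Rightarrow> 'v::ab_group_add) \<Rightarrow>
    ('m, 'k, 'v) comodule_data \<Rightarrow> bool" where
  "polynomial_module A s V \<longleftrightarrow>
     module.subspace s (underlying_space V) \<and>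
     (\<forall>v\<in>underlying_space V. set_mset (coact V v) \<subseteq> underlying_space V \<times> A) \<and>
     (\<forall>u\<in>underlying_space V. \<forall>v\<in>underlying_space V.
        tensor_eq s fun_scale (underlying_space V) A (coact V (u + v)) (coact V u + coact V v)) \<and>
     (\<forall>c. \<forall>v\<in>underlying_space V.
        tensor_eq s fun_scale (underlying_space V) A
          (coact V (s c v)) {# (s c v0, v1). (v0, v1) \<in># coact V v #}) \<and>
     (\<forall>v\<in>underlying_space V.
        tensor3_eq s fun_scale fun_scale (underlying_space V) A A
          (\<Sum>(v0, v1)\<in>#coact V v. {# (w0, w1, v1). (w0, w1) \<in># coact V v0 #})
          (\<Sum>(v0, v1)\<in>#coact V v. {# (v0, g, h). (g, h) \<in># comultiplication A v1 #})) \<and>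
     (\<forall>v\<in>underlying_space V. (\<Sum>(v0, v1)\<in>#coact V v. s (counit v1) v0) = v)"

definition invariants ::
  "('m \<Rightarrow> 'k::comm_ring_1) set \<Rightarrow> ('k \<Rightarrow> 'v \<Rightarrow> 'v::ab_group_add) \<Rightarrow>
    ('m, 'k, 'v) comodule_data \<Rightarrow> 'v set" where
  "invariants A s V =
     {v \<in> underlying_space V. tensor_eq s fun_scale (underlying_space V) A (coact V v) {#(v, 1)#}}"

definition linear_between ::
  "('k \<Rightarrow> 'v \<Rightarrow> 'v::ab_group_add) \<Rightarrow> 'v set \<Rightarrow> 'v set \<Rightarrow> ('v \<Rightarrow> 'v) \<Rightarrow> bool" where
  "linear_between s V W f \<longleftrightarrow>
     f ` V \<subseteq> W \<and>
     (\<forall>u\<in>V. \<forall>v\<in>V. f (u + v) = f u + f v) \<and>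
     (\<forall>c. \<forall>v\<in>V. f (s c v) = s c (f v))"

definition module_morphism ::
  "('m \<Rightarrow> 'k::comm_ring_1) set \<Rightarrow> ('k \<Rightarrow> 'v \<Rightarrow> 'v::ab_group_add) \<Rightarrow>
    ('m, 'k, 'v) comodule_data \<Rightarrow> ('m, 'k, 'v) comodule_data \<Rightarrow> ('v \<Rightarrow> 'v) \<Rightarrow> bool" where
  "module_morphism A s V W f \<longleftrightarrow>
     linear_between s (underlying_space V) (underlying_space W) f \<and>
     (\<forall>v\<in>underlying_space V.
        tensor_eq s fun_scale (underlying_space W) A
          (coact W (f v)) {# (f v0, v1). (v0, v1) \<in># coact V v #})"

definition reynolds_operator ::
  "('m::monoid_mult \<Rightarrow> 'k::field) set \<Rightarrow> ('k \<Rightarrow> 'v \<Rightarrow> 'v::ab_group_add) \<Rightarrow>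
    (('m, 'k, 'v) comodule_data \<Rightarrow> 'v \<Rightarrow> 'v) \<Rightarrow> bool" where
  "reynolds_operator A s R \<longleftrightarrow>
     (\<forall>V. polynomial_module A s V \<longrightarrow>
        linear_between s (underlying_space V) (underlying_space V) (R V) \<and>
        R V ` underlying_space V \<subseteq> invariants A s V \<and>
        (\<forall>v\<in>invariants A s V. R V v = v)) \<and>
     (\<forall>V W f. polynomial_module A s V \<and> polynomial_module A s W \<and> module_morphism A s V W f \<longrightarrow>
        (\<forall>v\<in>underlying_space V. f (R V v) = R W (f v)))"


section \<open>Omega-processes\<close>

definition left_translate :: "'m::monoid_mult \<Rightarrow> ('m \<Rightarrow> 'k) \<Rightarrow> 'm \<Rightarrow> 'k" where
  "left_translate m f = (\<lambda>x. f (x * m))"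

definition right_translate :: "('m::monoid_mult \<Rightarrow> 'k) \<Rightarrow> 'm \<Rightarrow> 'm \<Rightarrow> 'k" where
  "right_translate f m = (\<lambda>x. f (m * x))"

definition omega_process ::
  "('m::monoid_mult \<Rightarrow> 'k::field) set \<Rightarrow> ('m \<Rightarrow> 'k) \<Rightarrow> (('m \<Rightarrow> 'k) \<Rightarrow> ('m \<Rightarrow> 'k)) \<Rightarrow> bool" where
  "omega_process A lam Om \<longleftrightarrow>
     linear_between fun_scale A A Om \<and>
     (\<exists>f\<in>A. Om f \<noteq> 0) \<and>
     (\<forall>f\<in>A. \<forall>m.
        Om (right_translate f m) = fun_scale (lam m) (right_translate (Om f) m) \<and>
        Om (left_translate m f) = fun_scale (lam m) (left_translate m (Om f)))"

definition omega_coeff ::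
  "(('m::monoid_mult \<Rightarrow> 'k::field) \<Rightarrow> ('m \<Rightarrow> 'k)) \<Rightarrow> ('m \<Rightarrow> 'k) \<Rightarrow> nat \<Rightarrow> 'k" where
  "omega_coeff Om lam r = Om (lam ^ r) 1"

definition proper_omega_process ::
  "('m::monoid_mult \<Rightarrow> 'k::field) set \<Rightarrow> ('m \<Rightarrow> 'k) \<Rightarrow> (('m \<Rightarrow> 'k) \<Rightarrow> ('m \<Rightarrow> 'k)) \<Rightarrow> bool" where
  "proper_omega_process A lam Om \<longleftrightarrow>
     omega_process A lam Om \<and> (\<forall>r\<ge>1. omega_coeff Om lam r \<noteq> 0)"

text \<open>
  A monoid with a zero element is a monoid whose type is moreover of class \<^class>\<open>mult_zero\<close>, i.e.
  \<open>0 * m = 0 = m * 0\<close>; no additive structure on the monoid is involved.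
\<close>

definition I11 ::
  "('k \<Rightarrow> 'v \<Rightarrow> 'v::ab_group_add) \<Rightarrow> ('m::zero \<Rightarrow> 'k::field) \<Rightarrow> (('m \<Rightarrow> 'k) \<Rightarrow> ('m \<Rightarrow> 'k)) \<Rightarrow>
    ('m, 'k, 'v) comodule_data \<Rightarrow> 'v \<Rightarrow> 'v" where
  "I11 s lam Om V v = (\<Sum>(v0, v1)\<in>#coact V v. s (Om (lam * v1) 0) v0)"

end

theory Submission
  imports Defs
begin

text \<open>
  One invariant mean on the coordinate algebra \<open>A\<close>, that is a linear functional \<open>J\<close> with \<open>J 1 = 1\<close>
  and \<open>J (f \<cdot> m) = J f\<close>, averages all polynomial modules at once: put
  \<open>R v = \<Sum> J(v\<^sub>1) v\<^sub>0\<close>. Naturality and \<open>R v = v\<close> for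
  invariant \<open>v\<close> are immediate once this contraction is known to depend on the tensor \<open>\<chi>(v)\<close> only.
  That \<open>R v\<close> is invariant is coassociativity: \<open>\<chi>(R v) = \<Sum> v\<^sub>0 \<otimes> J(v\<^sub>2) v\<^sub>1\<close>, and
  \<open>\<Sum> J(f\<^sub>2) f\<^sub>1\<close> is the function \<open>m \<mapsto> J (f \<cdot> m)\<close>, which is the constant \<open>J f\<close>.
  This is \<open>average_invariant\<close>, the core of \<open>reynolds_operator_average\<close>.

  The functional in question is \<open>J f = \<Omega>(\<lambda>f)(0) / \<Omega>(\<lambda>)\<close>. Since \<open>(\<lambda>f) \<cdot> m = \<lambda>(m) \<lambda> (f \<cdot> m)\<close>,
  the covariance of \<open>\<Omega>\<close> gives \<open>\<lambda>(m) \<Omega>(\<lambda> (f \<cdot> m))(x) = \<lambda>(m) \<Omega>(\<lambda>f)(mx)\<close>. At \<open>x = 0\<close>, where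
  \<open>mx = 0\<close>, this is the invariance of \<open>J\<close> up to the factor \<open>\<lambda>(m)\<close>; both sides are regular
  functions of \<open>m\<close>, and as \<open>A\<close> is an integral domain the non-zero factor \<open>\<lambda>\<close> cancels.
  The same identity with \<open>f = 1\<close>, taken at \<open>x = 1\<close>, shows that \<open>\<Omega>(\<lambda>)\<close> is constant, so that \<open>J 1 = 1\<close>; properness
  makes the division possible.
\<close>

section \<open>Maps out of tensor products\<close>

text \<open>
  The universal property of the quotient by the generated congruence. Taking \<open>E\<close> to be equality
  gives maps from tensors to a vector space, taking \<open>E\<close> to be another tensor congruence gives maps
  between tensor products.
\<close>

lemma generated_congruence_induced_map:
  fixes F :: "'a multiset \<Rightarrow> 'b::comm_monoid_add"
  assumes "generated_congruence R t t'"
    and "equivp E"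
    and "\<And>a a' b b'. E a a' \<Longrightarrow> E b b' \<Longrightarrow> E (a + b) (a' + b')"
    and "\<And>a b. F (a + b) = F a + F b"
    and "\<And>a a'. R a a' \<Longrightarrow> E (F a) (F a')"
  shows "E (F t) (F t')"
  using assms(1)
proof (induction rule: generated_congruence.induct)
  case (congruence_base t t')
  then show ?case by (rule assms(5))
next
  case (congruence_refl t)
  show ?case using assms(2) by (rule equivp_reflp)
next
  case (congruence_sym t t')
  then show ?case using equivp_symp[OF assms(2)] by blast
next
  case (congruence_trans t t' t'')
  then show ?case using equivp_transp[OF assms(2)] by blast
next
  case (congruence_add t t' r r')
  then show ?case by (simp add: assms(3,4))
qed

lemma tensor_eq_refl: "tensor_eq s s' U W t t"
  unfolding tensor_eq_def by (rule congruence_refl)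

lemma tensor_eq_sym: "tensor_eq s s' U W t t' \<Longrightarrow> tensor_eq s s' U W t' t"
  unfolding tensor_eq_def by (rule congruence_sym)

lemma tensor_eq_trans [trans]:
  "tensor_eq s s' U W t t' \<Longrightarrow> tensor_eq s s' U W t' t'' \<Longrightarrow> tensor_eq s s' U W t t''"
  unfolding tensor_eq_def by (rule congruence_trans)

lemma tensor_eq_add:
  "tensor_eq s s' U W t t' \<Longrightarrow> tensor_eq s s' U W r r' \<Longrightarrow> tensor_eq s s' U W (t + r) (t' + r')"
  unfolding tensor_eq_def by (rule congruence_add)

lemma equivp_tensor_eq: "equivp (tensor_eq s s' U W)"
  by (rule equivpI)
    (auto simp: reflp_def symp_def transp_def
      intro: tensor_eq_refl tensor_eq_sym tensor_eq_trans)

lemma tensor_eq_base: "bilinear_rel s s' U W t t' \<Longrightarrow> tensor_eq s s' U W t t'"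
  unfolding tensor_eq_def by (rule congruence_base)

lemma tensor_eq_sum_mset:
  assumes "\<And>x. x \<in># t \<Longrightarrow> tensor_eq s s' U W (p x) (q x)"
  shows "tensor_eq s s' U W (\<Sum>x\<in>#t. p x) (\<Sum>x\<in>#t. q x)"
  using assms by (induction t) (auto intro: tensor_eq_refl tensor_eq_add)

lemma sum_mset_fun_apply:
  fixes p :: "'a \<Rightarrow> 'm \<Rightarrow> 'k::comm_monoid_add"
  shows "(\<Sum>a\<in>#t. p a) x = (\<Sum>a\<in>#t. p a x)"
  by (induction t) (auto simp: zero_fun_def plus_fun_def)


section \<open>Linear functionals on a bialgebra of functions\<close>

locale bialgebra_functional =
  fixes A :: "('m::monoid_mult \<Rightarrow> 'k::field) set"
    and J :: "('m \<Rightarrow> 'k) \<Rightarrow> 'k"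
  assumes one_mem: "1 \<in> A"
    and add_mem: "f \<in> A \<Longrightarrow> g \<in> A \<Longrightarrow> f + g \<in> A"
    and scale_mem: "f \<in> A \<Longrightarrow> fun_scale c f \<in> A"
    and coproduct_exists:
      "f \<in> A \<Longrightarrow> \<exists>t. set_mset t \<subseteq> A \<times> A \<and> (\<forall>x y. f (x * y) = (\<Sum>(g, h)\<in>#t. g x * h y))"
    and functional_add: "f \<in> A \<Longrightarrow> g \<in> A \<Longrightarrow> J (f + g) = J f + J g"
    and functional_scale: "f \<in> A \<Longrightarrow> J (fun_scale c f) = c * J f"
begin

lemma zero_mem: "0 \<in> A"
  using scale_mem[OF one_mem, of 0] by (simp add: fun_scale_def zero_fun_def)

lemma functional_zero: "J 0 = 0"
  using functional_scale[OF one_mem, of 0] by (simp add: fun_scale_def zero_fun_def)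

lemma comultiplication_props:
  assumes "f \<in> A"
  shows "set_mset (comultiplication A f) \<subseteq> A \<times> A"
    and "f (x * y) = (\<Sum>(g, h)\<in>#comultiplication A f. g x * h y)"
  using someI_ex[OF coproduct_exists[OF assms], folded comultiplication_def] by blast+

lemma functional_sum:
  assumes "set_mset t \<subseteq> A \<times> A"
  shows "(\<Sum>(g, h)\<in>#t. fun_scale (c g) h) \<in> A"
    and "J (\<Sum>(g, h)\<in>#t. fun_scale (c g) h) = (\<Sum>(g, h)\<in>#t. c g * J h)"
proof -
  have "(\<Sum>(g, h)\<in>#t. fun_scale (c g) h) \<in> A \<and>
      J (\<Sum>(g, h)\<in>#t. fun_scale (c g) h) = (\<Sum>(g, h)\<in>#t. c g * J h)"
    using assms
    by (induction t)
      (auto simp: zero_mem functional_zero add_mem scale_mem functional_add functional_scale)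
  then show "(\<Sum>(g, h)\<in>#t. fun_scale (c g) h) \<in> A"
    and "J (\<Sum>(g, h)\<in>#t. fun_scale (c g) h) = (\<Sum>(g, h)\<in>#t. c g * J h)" by auto
qed

lemma right_translate_eq_sum:
  assumes "f \<in> A"
  shows "right_translate f m = (\<Sum>(g, h)\<in>#comultiplication A f. fun_scale (g m) h)"
  by (rule ext)
    (simp add: right_translate_def comultiplication_props(2)[OF assms] sum_mset_fun_apply
      fun_scale_def case_prod_unfold)

lemma right_translate_mem: "f \<in> A \<Longrightarrow> right_translate f m \<in> A"
  using functional_sum(1)[OF comultiplication_props(1), of f "\<lambda>g. g m"]
  by (simp add: right_translate_eq_sum)

text \<open>
  Convolution with \<open>J\<close>: as \<open>f \<cdot> m = \<Sum> f\<^sub>1(m) f\<^sub>2\<close>, applying \<open>J\<close> to the second tensor factor of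
  \<open>\<Delta>(f)\<close> averages the translates of \<open>f\<close>. In particular this average is regular in \<open>m\<close>.
\<close>

lemma convolution_eq:
  assumes "f \<in> A"
  shows "(\<Sum>(g, h)\<in>#comultiplication A f. fun_scale (J h) g) = (\<lambda>m. J (right_translate f m))"
proof
  fix m
  let ?t = "comultiplication A f"
  have "J (right_translate f m) = (\<Sum>(g, h)\<in>#?t. g m * J h)"
    using functional_sum(2)[OF comultiplication_props(1)[OF assms], of "\<lambda>g. g m"]
    by (simp add: right_translate_eq_sum[OF assms])
  then show "(\<Sum>(g, h)\<in>#?t. fun_scale (J h) g) m = J (right_translate f m)"
    by (simp add: sum_mset_fun_apply fun_scale_def case_prod_unfold mult.commute)
qed

lemma convolution_sum_mem:
  assumes "set_mset t \<subseteq> A \<times> A"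
  shows "(\<Sum>(g, h)\<in>#t. fun_scale (J h) g) \<in> A"
  using assms by (induction t) (auto simp: zero_mem add_mem scale_mem)

lemma convolution_mem:
  assumes "f \<in> A"
  shows "(\<lambda>m. J (right_translate f m)) \<in> A"
  using convolution_sum_mem[OF comultiplication_props(1)[OF assms]] convolution_eq[OF assms] by simp

end


section \<open>Contracting a comodule with a functional\<close>

definition contract ::
  "('k \<Rightarrow> 'v \<Rightarrow> 'v::ab_group_add) \<Rightarrow> (('m \<Rightarrow> 'k) \<Rightarrow> 'k) \<Rightarrow> ('v \<times> ('m \<Rightarrow> 'k)) multiset \<Rightarrow> 'v" where
  "contract s J t = (\<Sum>(v, f)\<in>#t. s (J f) v)"

definition contract_last ::
  "('k \<Rightarrow> 'v \<Rightarrow> 'v::ab_group_add) \<Rightarrow> (('m \<Rightarrow> 'k) \<Rightarrow> 'k) \<Rightarrow>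
    ('v \<times> ('m \<Rightarrow> 'k) \<times> ('m \<Rightarrow> 'k)) multiset \<Rightarrow> ('v \<times> ('m \<Rightarrow> 'k)) multiset" where
  "contract_last s J t = {# (s (J h) v, g). (v, g, h) \<in># t #}"

lemma contract_simps [simp]:
  "contract s J {#} = 0"
  "contract s J (add_mset (v, f) t) = s (J f) v + contract s J t"
  "contract s J (t + t') = contract s J t + contract s J t'"
  by (simp_all add: contract_def)

lemma contract_last_simps [simp]:
  "contract_last s J {#} = {#}"
  "contract_last s J (add_mset (v, g, h) t) = add_mset (s (J h) v, g) (contract_last s J t)"
  "contract_last s J (t + t') = contract_last s J t + contract_last s J t'"
  by (simp_all add: contract_last_def)

locale comodule_contraction =
  bialgebra_functional A J + vector_space s
  for A :: "('m::monoid_mult \<Rightarrow> 'k::field) set"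
    and J :: "('m \<Rightarrow> 'k) \<Rightarrow> 'k"
    and s :: "'k \<Rightarrow> 'v \<Rightarrow> 'v::ab_group_add"
begin

lemma contract_cong:
  assumes "tensor_eq s fun_scale U A t t'"
  shows "contract s J t = contract s J t'"
proof (rule generated_congruence_induced_map[where E = "(=)" and F = "contract s J",
      OF assms[unfolded tensor_eq_def]])
  fix a a' :: "('v \<times> ('m \<Rightarrow> 'k)) multiset"
  assume "bilinear_rel s fun_scale U A a a'"
  then show "contract s J a = contract s J a'"
    by cases
      (auto simp: functional_add functional_scale scale_right_distrib scale_left_distrib mult.commute)
qed (auto simp: identity_equivp)

lemma contract_last_cong:
  assumes "subspace U"
    and "tensor3_eq s fun_scale fun_scale U A A t t'"
  shows "tensor_eq s fun_scale U A (contract_last s J t) (contract_last s J t')"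
proof (rule generated_congruence_induced_map[OF assms(2)[unfolded tensor3_eq_def] equivp_tensor_eq])
  fix a a' :: "('v \<times> ('m \<Rightarrow> 'k) \<times> ('m \<Rightarrow> 'k)) multiset"
  assume "trilinear_rel s fun_scale fun_scale U A A a a'"
  then show "tensor_eq s fun_scale U A (contract_last s J a) (contract_last s J a')"
  proof cases
    case (trilinear_zero w x)
    then show ?thesis by (auto intro!: tensor_eq_base bilinear_zero)
  next
    case (trilinear_add1 u u' w x)
    then show ?thesis
      using bilinear_add_left[of "s (J x) u" U "s (J x) u'" w A s fun_scale]
      by (auto intro!: tensor_eq_base simp: scale_right_distrib subspace_scale[OF assms(1)])
  next
    case (trilinear_add2 u w w' x)
    then show ?thesis
      using bilinear_add_right[of "s (J x) u" U w A w' s fun_scale]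
      by (auto intro!: tensor_eq_base simp: subspace_scale[OF assms(1)])
  next
    case (trilinear_add3 u w x x')
    then show ?thesis
      using bilinear_add_left[of "s (J x) u" U "s (J x') u" w A s fun_scale]
      by (auto intro!: tensor_eq_base
          simp: scale_left_distrib functional_add subspace_scale[OF assms(1)])
  next
    case (trilinear_scale12 u w x c)
    then show ?thesis
      using bilinear_scale[of "s (J x) u" U w A s fun_scale c]
      by (auto intro!: tensor_eq_base simp: mult.commute subspace_scale[OF assms(1)])
  next
    case (trilinear_scale23 u w x c)
    then show ?thesis
      using bilinear_scale[of "s (J x) u" U w A s fun_scale c]
      by (auto intro!: tensor_eq_sym[OF tensor_eq_base]
          simp: functional_scale subspace_scale[OF assms(1)])
  qed
qed (auto intro: tensor_eq_add)

lemma contract_mem: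
  assumes "subspace U" and "set_mset t \<subseteq> U \<times> A"
  shows "contract s J t \<in> U"
  using assms(2)
  by (induction t) (auto simp: subspace_0[OF assms(1)] subspace_add[OF assms(1)] subspace_scale[OF assms(1)])

lemma contract_scale:
  "contract s J {# (s c v, f). (v, f) \<in># t #} = s c (contract s J t)"
  by (induction t) (auto simp: scale_right_distrib mult.commute)

text \<open>\<open>u \<otimes> 0 = u \<otimes> 0\<cdot>1 = 0\<cdot>u \<otimes> 1 = 0\<close>.\<close>

lemma tensor_eq_zero_right:
  assumes "u \<in> U" and "0 \<in> U"
  shows "tensor_eq s fun_scale U A {#(u, 0)#} {#}"
proof -
  have "tensor_eq s fun_scale U A {#(0, 1)#} {#(u, 0)#}"
    using tensor_eq_base[OF bilinear_scale[OF assms(1) one_mem, of s fun_scale 0]]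
    by (simp add: fun_scale_def zero_fun_def)
  from tensor_eq_trans[OF tensor_eq_sym[OF this] tensor_eq_base[OF bilinear_zero[OF one_mem]]]
  show ?thesis .
qed

lemma tensor_eq_collect_right:
  assumes "subspace U" and "u \<in> U" and "set_mset t \<subseteq> A \<times> A"
  shows "tensor_eq s fun_scale U A {# (s (J h) u, g). (g, h) \<in># t #}
    {#(u, \<Sum>(g, h)\<in>#t. fun_scale (J h) g)#}"
  using assms(3)
proof (induction t)
  case empty
  show ?case
    using tensor_eq_sym[OF tensor_eq_zero_right[OF assms(2) subspace_0[OF assms(1)]]]
    by (simp add: zero_fun_def)
next
  case (add p t)
  obtain g h where p: "p = (g, h)" by force
  let ?S = "\<Sum>(g, h)\<in>#t. fun_scale (J h) g"
  have g: "g \<in> A" using add.prems p by auto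
  have S: "?S \<in> A" using add.prems by (intro convolution_sum_mem) auto
  have "tensor_eq s fun_scale U A ({#(s (J h) u, g)#} + {# (s (J h) u, g). (g, h) \<in># t #})
      ({#(u, fun_scale (J h) g)#} + {#(u, ?S)#})"
    using add by (intro tensor_eq_add tensor_eq_base[OF bilinear_scale[OF assms(2) g]]) auto
  also have "tensor_eq s fun_scale U A \<dots> {#(u, fun_scale (J h) g + ?S)#}"
    using tensor_eq_sym[OF tensor_eq_base[OF bilinear_add_right[OF assms(2) scale_mem[OF g] S]]]
    by (simp add: add_mset_commute)
  finally show ?case by (simp add: p plus_fun_def)
qed

lemma tensor_eq_collect_left:
  assumes "subspace U" and "set_mset t \<subseteq> U \<times> A" and "w \<in> A"
  shows "tensor_eq s fun_scale U A {# (s (J f) u, w). (u, f) \<in># t #} {#(contract s J t, w)#}"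
  using assms(2)
proof (induction t)
  case empty
  show ?case using tensor_eq_sym[OF tensor_eq_base[OF bilinear_zero[OF assms(3)]]] by simp
next
  case (add p t)
  obtain u f where p: "p = (u, f)" by force
  have mem: "s (J f) u \<in> U" "contract s J t \<in> U"
    using add.prems p contract_mem[OF assms(1)] subspace_scale[OF assms(1)] by auto
  have "tensor_eq s fun_scale U A ({#(s (J f) u, w)#} + {# (s (J f) u, w). (u, f) \<in># t #})
      ({#(s (J f) u, w)#} + {#(contract s J t, w)#})"
    using add by (intro tensor_eq_add tensor_eq_refl) auto
  also have "tensor_eq s fun_scale U A \<dots> {#(s (J f) u + contract s J t, w)#}"
    using tensor_eq_sym[OF tensor_eq_base[OF bilinear_add_left[OF mem assms(3)]]]
    by (simp add: add_mset_commute)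
  finally show ?case by (simp add: p)
qed

end


section \<open>Invariant means give Reynolds operators\<close>

text \<open>
  Invariance under \<open>f \<mapsto> f \<cdot> m\<close> is the side that matters, because coassociativity leaves \<open>J\<close> acting
  on the second factor of \<open>\<Delta>(v\<^sub>1)\<close>.
\<close>

locale invariant_mean = bialgebra_functional +
  assumes invariant: "f \<in> A \<Longrightarrow> J (right_translate f m) = J f"
    and normalized: "J 1 = 1"
begin

lemma convolution_constant:
  assumes "f \<in> A"
  shows "(\<Sum>(g, h)\<in>#comultiplication A f. fun_scale (J h) g) = fun_scale (J f) 1"
  unfolding convolution_eq[OF assms] invariant[OF assms] by (simp add: fun_scale_def one_fun_def)

end

locale comodule_averaging =
  invariant_mean A J + comodule_contraction A J s
  for A :: "('m::monoid_mult \<Rightarrow> 'k::field) set"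
    and J :: "('m \<Rightarrow> 'k) \<Rightarrow> 'k"
    and s :: "'k \<Rightarrow> 'v \<Rightarrow> 'v::ab_group_add"
begin

text \<open>
  The coaction is linear only up to equality of tensors; this extends it to the linear combination
  that defines the average.
\<close>

lemma coact_contract:
  assumes V: "polynomial_module A s V"
    and "set_mset t \<subseteq> underlying_space V \<times> A"
  shows "tensor_eq s fun_scale (underlying_space V) A
    (coact V (contract s J t))
    (\<Sum>(v, f)\<in>#t. {# (s (J f) w, g). (w, g) \<in># coact V v #})"
  using assms(2)
proof (induction t)
  case empty
  \<comment> \<open>\<open>\<chi>(0) = 0\<close> comes from compatibility with scaling by \<open>0\<close>, applied to \<open>0\<close>.\<close>
  let ?U = "underlying_space V"
  have U: "subspace ?U"
    using V by (simp add: polynomial_module_def)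
  have scale: "tensor_eq s fun_scale ?U A (coact V (s 0 0)) {# (s 0 w, g). (w, g) \<in># coact V 0 #}"
    using V subspace_0[OF U] unfolding polynomial_module_def by blast
  have sub: "set_mset (coact V 0) \<subseteq> ?U \<times> A"
    using V subspace_0[OF U] unfolding polynomial_module_def by blast
  have "tensor_eq s fun_scale ?U A {# (0, g). (w, g) \<in># r #} {#}" if "set_mset r \<subseteq> ?U \<times> A" for r
    using that
  proof (induction r)
    case (add p r)
    then show ?case
      using tensor_eq_add[OF tensor_eq_base[OF bilinear_zero]] by (cases p) force
  qed (simp add: tensor_eq_refl)
  from tensor_eq_trans[OF scale] this[OF sub] show ?case by simp
next
  case (add p t)
  let ?U = "underlying_space V"
  obtain v f where p: "p = (v, f)" by force
  have U: "subspace ?U"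
    using V by (simp add: polynomial_module_def)
  have v: "v \<in> ?U" and t: "contract s J t \<in> ?U"
    using add.prems p contract_mem[OF U] by auto
  have "tensor_eq s fun_scale ?U A (coact V (s (J f) v + contract s J t))
      (coact V (s (J f) v) + coact V (contract s J t))"
    using V v t subspace_scale[OF U] by (simp add: polynomial_module_def)
  also have "tensor_eq s fun_scale ?U A \<dots>
      ({# (s (J f) w, g). (w, g) \<in># coact V v #} +
        (\<Sum>(v, f)\<in>#t. {# (s (J f) w, g). (w, g) \<in># coact V v #}))"
    using V v add by (intro tensor_eq_add) (auto simp: polynomial_module_def)
  finally show ?case by (simp add: p)
qed

text \<open>
  The two sides of the coassociativity law, \<open>(\<chi> \<otimes> id) \<chi>(v)\<close> and \<open>(id \<otimes> \<Delta>) \<chi>(v)\<close>, after \<open>J\<close> is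
  applied to the last factor.
\<close>

lemma contract_last_coact_left:
  "contract_last s J (\<Sum>(v, f)\<in>#t. {# (w, g, f). (w, g) \<in># r v #}) =
    (\<Sum>(v, f)\<in>#t. {# (s (J f) w, g). (w, g) \<in># r v #})"
proof -
  have "contract_last s J {# (w, g, f). (w, g) \<in># q #} = {# (s (J f) w, g). (w, g) \<in># q #}" for f q
    by (induction q) auto
  then show ?thesis by (induction t) auto
qed

lemma contract_last_coact_right:
  "contract_last s J (\<Sum>(v, f)\<in>#t. {# (v, g, h). (g, h) \<in># d f #}) =
    (\<Sum>(v, f)\<in>#t. {# (s (J h) v, g). (g, h) \<in># d f #})"
proof -
  have "contract_last s J {# (v, g, h). (g, h) \<in># q #} = {# (s (J h) v, g). (g, h) \<in># q #}" for v q
    by (induction q) auto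
  then show ?thesis by (induction t) auto
qed

text \<open>
  Coassociativity moves the average from \<open>V\<close> to the algebra, where invariance of \<open>J\<close> makes it
  constant: \<open>\<chi>(\<Sum> J(v\<^sub>1) v\<^sub>0) = \<Sum> v\<^sub>0 \<otimes> J(v\<^sub>2) v\<^sub>1 = \<Sum> v\<^sub>0 \<otimes> J(v\<^sub>1) 1\<close>.
\<close>

lemma average_invariant:
  assumes V: "polynomial_module A s V" and v: "v \<in> underlying_space V"
  shows "contract s J (coact V v) \<in> invariants A s V"
proof -
  let ?U = "underlying_space V"
  let ?c = "coact V v"
  have U: "subspace ?U" and c: "set_mset ?c \<subseteq> ?U \<times> A"
    and coassoc: "tensor3_eq s fun_scale fun_scale ?U A A
      (\<Sum>(v0, v1)\<in>#?c. {# (w0, w1, v1). (w0, w1) \<in># coact V v0 #})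
      (\<Sum>(v0, v1)\<in>#?c. {# (v0, g, h). (g, h) \<in># comultiplication A v1 #})"
    using V v by (auto simp: polynomial_module_def)
  have sum_singletons:
    "(\<Sum>(v0, v1)\<in>#t. {# (s (J v1) v0, 1) #}) = {# (s (J v1) v0, 1). (v0, v1) \<in># t #}"
    for t :: "('v \<times> ('m \<Rightarrow> 'k)) multiset"
    by (induction t) auto
  have "tensor_eq s fun_scale ?U A (coact V (contract s J ?c))
      (\<Sum>(v0, v1)\<in>#?c. {# (s (J v1) w, g). (w, g) \<in># coact V v0 #})"
    by (rule coact_contract[OF V c])
  also have "tensor_eq s fun_scale ?U A \<dots>
      (\<Sum>(v0, v1)\<in>#?c. {# (s (J h) v0, g). (g, h) \<in># comultiplication A v1 #})"
    using contract_last_cong[OF U coassoc]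
    by (simp only: contract_last_coact_left contract_last_coact_right)
  also have "tensor_eq s fun_scale ?U A \<dots> (\<Sum>(v0, v1)\<in>#?c. {# (s (J v1) v0, 1) #})"
  proof (rule tensor_eq_sum_mset, clarify)
    fix v0 v1 assume "(v0, v1) \<in># ?c"
    then have v0: "v0 \<in> ?U" and v1: "v1 \<in> A" using c by auto
    have "tensor_eq s fun_scale ?U A {# (s (J h) v0, g). (g, h) \<in># comultiplication A v1 #}
        {#(v0, fun_scale (J v1) 1)#}"
      using tensor_eq_collect_right[OF U v0 comultiplication_props(1)[OF v1]]
      by (simp add: convolution_constant[OF v1])
    also have "tensor_eq s fun_scale ?U A \<dots> {#(s (J v1) v0, 1)#}"
      by (rule tensor_eq_sym[OF tensor_eq_base[OF bilinear_scale[OF v0 one_mem]]])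
    finally show "tensor_eq s fun_scale ?U A
        {# (s (J h) v0, g). (g, h) \<in># comultiplication A v1 #} {#(s (J v1) v0, 1)#}" .
  qed
  also have "(\<Sum>(v0, v1)\<in>#?c. {# (s (J v1) v0, 1) #}) = {# (s (J v1) v0, 1). (v0, v1) \<in># ?c #}"
    by (rule sum_singletons)
  also have "tensor_eq s fun_scale ?U A \<dots> {#(contract s J ?c, 1)#}"
    by (rule tensor_eq_collect_left[OF U c one_mem])
  finally show ?thesis
    using contract_mem[OF U c] by (simp add: invariants_def)
qed

theorem reynolds_operator_average: "reynolds_operator A s (\<lambda>V v. contract s J (coact V v))"
  unfolding reynolds_operator_def
proof (intro conjI allI impI ballI)
  fix V :: "('m, 'k, 'v) comodule_data"
  assume V: "polynomial_module A s V"
  let ?U = "underlying_space V"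
  have U: "subspace ?U" using V by (simp add: polynomial_module_def)
  show "linear_between s ?U ?U (\<lambda>v. contract s J (coact V v))"
    unfolding linear_between_def
  proof (intro conjI allI ballI)
    show "(\<lambda>v. contract s J (coact V v)) ` ?U \<subseteq> ?U"
      using V contract_mem[OF U] by (auto simp: polynomial_module_def)
  next
    fix u v assume "u \<in> ?U" "v \<in> ?U"
    then have "tensor_eq s fun_scale ?U A (coact V (u + v)) (coact V u + coact V v)"
      using V by (simp add: polynomial_module_def)
    from contract_cong[OF this]
    show "contract s J (coact V (u + v)) = contract s J (coact V u) + contract s J (coact V v)"
      by simp
  next
    fix c v assume "v \<in> ?U"
    then have "tensor_eq s fun_scale ?U A (coact V (s c v)) {# (s c v0, v1). (v0, v1) \<in># coact V v #}"
      using V by (simp add: polynomial_module_def)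
    from contract_cong[OF this]
    show "contract s J (coact V (s c v)) = s c (contract s J (coact V v))"
      by (simp add: contract_scale)
  qed
  show "(\<lambda>v. contract s J (coact V v)) ` ?U \<subseteq> invariants A s V"
    using average_invariant[OF V] by auto
  fix v assume "v \<in> invariants A s V"
  then have "tensor_eq s fun_scale ?U A (coact V v) {#(v, 1)#}"
    by (simp add: invariants_def)
  from contract_cong[OF this] show "contract s J (coact V v) = v"
    by (simp add: normalized)
next
  fix V W :: "('m, 'k, 'v) comodule_data" and f v
  assume "polynomial_module A s V \<and> polynomial_module A s W \<and> module_morphism A s V W f"
    and v: "v \<in> underlying_space V"
  then have V: "polynomial_module A s V" and f: "module_morphism A s V W f" by auto
  let ?U = "underlying_space V"
  have U: "subspace ?U" and c: "set_mset (coact V v) \<subseteq> ?U \<times> A"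
    using V v by (auto simp: polynomial_module_def)
  have add: "f (a + b) = f a + f b" and scale: "f (s k a) = s k (f a)"
    if "a \<in> ?U" "b \<in> ?U" for a b k
    using f that by (auto simp: module_morphism_def linear_between_def)
  have zero: "f 0 = 0"
    using scale[OF subspace_0[OF U] subspace_0[OF U], of 0] by simp
  have "f (contract s J t) = contract s J {# (f v0, v1). (v0, v1) \<in># t #}"
    if "set_mset t \<subseteq> ?U \<times> A" for t
    using that
    by (induction t)
      (auto simp: zero add scale contract_mem[OF U] subspace_scale[OF U])
  then have "f (contract s J (coact V v)) = contract s J {# (f v0, v1). (v0, v1) \<in># coact V v #}"
    using c by blast
  also have "\<dots> = contract s J (coact W (f v))"
    using f v by (intro contract_cong[symmetric]) (auto simp: module_morphism_def)
  finally show "f (contract s J (coact V v)) = contract s J (coact W (f v))" .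
qed

end


section \<open>The mean defined by an Omega-process\<close>

text \<open>
  The coordinate algebra of an irreducible variety is an integral domain; for a multiplicative
  character \<open>\<lambda>\<close> the cancelled factor is non-zero because \<open>\<lambda>(1) = 1\<close>.
\<close>

lemma irreducible_variety_cancel:
  fixes A :: "('m \<Rightarrow> 'k::idom) set"
  assumes "irreducible_variety A"
    and "f \<in> A" and "g \<in> A" and "f a \<noteq> 0" and "\<And>x. f x * g x = 0"
  shows "g x = 0"
proof -
  let ?Z = "\<lambda>h. {x. h x = 0}"
  have "zariski_closed A (?Z h)" if "h \<in> A" for h
    unfolding zariski_closed_def using that by (intro exI[of _ "{h}"]) auto
  moreover have "?Z f \<union> ?Z g = UNIV" using assms(5) by auto
  ultimately have "?Z f = UNIV \<or> ?Z g = UNIV"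
    using assms(1-3) unfolding irreducible_variety_def by metis
  then show ?thesis using assms(4) by auto
qed

lemma affine_variety_closed:
  assumes "affine_variety A"
  shows "(\<lambda>_. c) \<in> A" and "1 \<in> A"
    and "f \<in> A \<Longrightarrow> g \<in> A \<Longrightarrow> f + g \<in> A" and "f \<in> A \<Longrightarrow> g \<in> A \<Longrightarrow> f * g \<in> A"
    and "f \<in> A \<Longrightarrow> fun_scale c f \<in> A"
proof -
  obtain G where A: "A = generated_algebra G"
    using assms by (auto simp: affine_variety_def)
  show const: "(\<lambda>_. c) \<in> A" for c
    unfolding A by (rule generated_algebra_const)
  then show "1 \<in> A" by (simp add: one_fun_def)
  show "f + g \<in> A" if "f \<in> A" "g \<in> A" for f g
    using that unfolding A by (rule generated_algebra_add)
  show mult: "f * g \<in> A" if "f \<in> A" "g \<in> A" for f g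
    using that unfolding A by (rule generated_algebra_mult)
  show "fun_scale c f \<in> A" if "f \<in> A"
    using mult[OF const that] by (simp add: fun_scale_def times_fun_def)
qed

lemma monoid_coproduct_exists:
  assumes "variety_morphism (product_algebra A A) A (\<lambda>(x, y). x * y)" and "f \<in> A"
  shows "\<exists>t. set_mset t \<subseteq> A \<times> A \<and> (\<forall>x y. f (x * y) = (\<Sum>(g, h)\<in>#t. g x * h y))"
proof -
  have "f \<circ> (\<lambda>(x, y). x * y) \<in> product_algebra A A"
    using assms by (simp add: variety_morphism_def)
  then obtain t where "set_mset t \<subseteq> A \<times> A"
    and "f \<circ> (\<lambda>(x, y). x * y) = (\<lambda>(x, y). \<Sum>(g, h)\<in>#t. g x * h y)"
    by (auto simp: product_algebra_def)
  then show ?thesis by (intro exI[of _ t]) (auto simp: fun_eq_iff)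
qed

text \<open>
  As \<open>\<lambda> \<cdot> m = \<lambda>(m) \<lambda>\<close>, linearity and covariance compute \<open>\<Omega>(\<lambda> \<cdot> m)\<close> as \<open>\<lambda>(m) \<Omega>(\<lambda>)\<close> and as
  \<open>\<lambda>(m) \<Omega>(\<lambda>) \<cdot> m\<close>; evaluating at \<open>1\<close> and cancelling \<open>\<lambda>\<close> leaves \<open>\<Omega>(\<lambda>)(m) = \<Omega>(\<lambda>)(1)\<close>.
\<close>

lemma omega_process_const:
  assumes irr: "irreducible_variety A"
    and char: "polynomial_character A lam" and Om: "omega_process A lam Om"
    and const_mem: "\<And>c. (\<lambda>_. c) \<in> A" and add: "\<And>f g. f \<in> A \<Longrightarrow> g \<in> A \<Longrightarrow> f + g \<in> A"
    and scale: "\<And>c f. f \<in> A \<Longrightarrow> fun_scale c f \<in> A"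
  shows "Om lam x = Om lam 1"
proof -
  have lam: "lam \<in> A" "lam 1 = 1" "\<And>x y. lam (x * y) = lam x * lam y"
    using char by (auto simp: polynomial_character_def)
  have Om_lam: "Om lam \<in> A"
    using Om lam by (auto simp: omega_process_def linear_between_def)
  have "lam m * (Om lam m - Om lam 1) = 0" for m
  proof -
    have "fun_scale (lam m) (Om lam) = Om (fun_scale (lam m) lam)"
      using Om lam by (auto simp: omega_process_def linear_between_def)
    also have "fun_scale (lam m) lam = right_translate lam m"
      by (simp add: fun_scale_def right_translate_def lam)
    also have "Om \<dots> = fun_scale (lam m) (right_translate (Om lam) m)"
      using Om lam by (auto simp: omega_process_def)
    finally have "fun_scale (lam m) (Om lam) 1 = fun_scale (lam m) (right_translate (Om lam) m) 1"
      by simp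
    then show ?thesis by (auto simp: fun_scale_def right_translate_def)
  qed
  moreover have "(\<lambda>m. Om lam m - Om lam 1) \<in> A"
    using add[OF Om_lam const_mem[of "- Om lam 1"]] by (simp add: plus_fun_def)
  ultimately have "Om lam x - Om lam 1 = 0"
    using irreducible_variety_cancel[OF irr lam(1), of "\<lambda>m. Om lam m - Om lam 1" 1 x] lam(2) by auto
  then show ?thesis by simp
qed

definition omega_mean ::
  "('m::{monoid_mult, mult_zero} \<Rightarrow> 'k::field) \<Rightarrow> (('m \<Rightarrow> 'k) \<Rightarrow> ('m \<Rightarrow> 'k)) \<Rightarrow> ('m \<Rightarrow> 'k) \<Rightarrow> 'k" where
  "omega_mean lam Om f = Om (lam * f) 0 / Om lam 1"

text \<open>
  Evaluation at \<open>0\<close> absorbs the translation that covariance moves outside \<open>\<Omega>\<close>. The factor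
  \<open>\<lambda>(m)\<close> left on both sides may vanish at some \<open>m\<close>, so it has to be cancelled in the algebra rather
  than pointwise; this is why \<open>convolution_mem\<close> is needed.
\<close>

lemma invariant_mean_omega_mean:
  assumes M: "affine_algebraic_monoid A"
    and char: "polynomial_character A lam"
    and Om: "omega_process A lam Om" and nonzero: "Om lam 1 \<noteq> 0"
  shows "invariant_mean A (omega_mean lam Om)"
proof -
  have var: "affine_variety A" and irr: "irreducible_variety A"
    and mor: "variety_morphism (product_algebra A A) A (\<lambda>(x, y). x * y)"
    using M by (auto simp: affine_algebraic_monoid_def)
  note closed = affine_variety_closed[OF var]
  have lam: "lam \<in> A" "lam 1 = 1" "\<And>x y. lam (x * y) = lam x * lam y"
    using char by (auto simp: polynomial_character_def)
  have Om_add: "Om (f + g) = Om f + Om g" and Om_scale: "Om (fun_scale c f) = fun_scale c (Om f)"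
    and Om_translate: "Om (right_translate f m) = fun_scale (lam m) (right_translate (Om f) m)"
    if "f \<in> A" "g \<in> A" for f g c m
    using Om that by (auto simp: omega_process_def linear_between_def)
  interpret bialgebra_functional A "omega_mean lam Om"
  proof
    fix f assume f: "f \<in> A"
    show "omega_mean lam Om (fun_scale c f) = c * omega_mean lam Om f" for c
    proof -
      have "lam * fun_scale c f = fun_scale c (lam * f)"
        by (simp add: fun_scale_def times_fun_def mult.left_commute)
      then have "Om (lam * fun_scale c f) = fun_scale c (Om (lam * f))"
        using f lam by (simp only: Om_scale closed)
      then show ?thesis
        by (simp add: omega_mean_def) (simp add: fun_scale_def)
    qed
    show "omega_mean lam Om (f + g) = omega_mean lam Om f + omega_mean lam Om g" if "g \<in> A" for g
    proof -
      have "lam * (f + g) = lam * f + lam * g"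
        by (simp add: times_fun_def plus_fun_def distrib_left)
      then show ?thesis
        using f that lam by (simp add: omega_mean_def Om_add closed add_divide_distrib)
    qed
  qed (use closed monoid_coproduct_exists[OF mor] in auto)
  show ?thesis
  proof
    show "omega_mean lam Om 1 = 1"
    proof -
      have "lam * 1 = lam" by (simp add: times_fun_def one_fun_def)
      then show ?thesis
        using nonzero omega_process_const[OF irr char Om closed(1,3,5), of 0]
        by (simp add: omega_mean_def)
    qed
  next
    fix f m assume f: "f \<in> A"
    define J where "J = omega_mean lam Om"
    have "lam m * (J (right_translate f m) - J f) = 0" for m
    proof -
      have f': "right_translate f m \<in> A"
        using f by (rule right_translate_mem)
      have "fun_scale (lam m) (lam * right_translate f m) = right_translate (lam * f) m"
        by (simp add: fun_scale_def right_translate_def times_fun_def lam mult.assoc)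
      then have "fun_scale (lam m) (Om (lam * right_translate f m)) =
          fun_scale (lam m) (right_translate (Om (lam * f)) m)"
        using Om_scale[of "lam * right_translate f m"] Om_translate[of "lam * f"] f f' lam closed
        by metis
      \<comment> \<open>At \<open>0\<close> the translation disappears, since \<open>m * 0 = 0\<close>.\<close>
      then have "fun_scale (lam m) (Om (lam * right_translate f m)) 0 =
          fun_scale (lam m) (right_translate (Om (lam * f)) m) 0"
        by simp
      then show ?thesis
        by (simp add: fun_scale_def right_translate_def J_def omega_mean_def
            right_diff_distrib)
    qed
    moreover have "(\<lambda>m. J (right_translate f m) - J f) \<in> A"
      using closed(3)[OF convolution_mem[OF f] closed(1)[of "- J f"]] by (simp add: plus_fun_def J_def)
    ultimately have "J (right_translate f m) - J f = 0"
      using irreducible_variety_cancel[OF irr lam(1), of "\<lambda>m. J (right_translate f m) - J f" 1 m] lam(2)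
      by auto
    then show "omega_mean lam Om (right_translate f m) = omega_mean lam Om f"
      by (simp add: J_def)
  qed
qed

theorem theorem11:
  fixes A :: "('m::{monoid_mult, mult_zero} \<Rightarrow> 'k::{alg_closed_field, field_char_0}) set"
    and lam :: "'m \<Rightarrow> 'k"
    and Om :: "('m \<Rightarrow> 'k) \<Rightarrow> ('m \<Rightarrow> 'k)"
    and s :: "'k \<Rightarrow> 'v \<Rightarrow> 'v::ab_group_add"
  assumes "affine_algebraic_monoid A"
    and "polynomial_character A lam"
    and "\<not> trivial_character lam"
    and "proper_omega_process A lam Om"
    and "vector_space s"
  shows "reynolds_operator A s (\<lambda>V v. s (1 / Om lam 1) (I11 s lam Om V v))"
proof -
  interpret vector_space s by fact
  have "Om lam 1 = omega_coeff Om lam 1"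
    by (simp add: omega_coeff_def)
  then have "omega_process A lam Om" and "Om lam 1 \<noteq> 0"
    using assms(4) by (auto simp: proper_omega_process_def)
  from invariant_mean_omega_mean[OF assms(1,2) this]
  interpret mean: invariant_mean A "omega_mean lam Om" .
  interpret averaging: comodule_averaging A "omega_mean lam Om" s ..
  have "s (1 / Om lam 1) (\<Sum>(v, f)\<in>#t. s (Om (lam * f) 0) v) = contract s (omega_mean lam Om) t" for t
    by (induction t) (auto simp: scale_right_distrib omega_mean_def times_fun_def)
  then show ?thesis
    using averaging.reynolds_operator_average by (simp add: I11_def)
qed

end
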